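(* Let $\eta>1$ and $2<s<4$. There exists a sequence of i.i.d. real random variables $(X_n)_{n\ge1}$ with $\mathbf E X_1=0$, $\mathbf E X_1^2=1$, $\mathbf E|X_1|^s<+\infty$ and $D(X_1)<+\infty$, such that for $Z_n=(X_1+\dots+X_n)/\sqrt n$, $$D(Z_n)\ge\frac{c(\eta)}{(n\log n)^{(s-2)/2}(\log n)^{\eta}}\qquad\text{for all } n\ge n_1(X_1),$$ where $c(\eta)>0$ is a constant depending only on $\eta$ and $n_1(X_1)$ depends on the distribution of $X_1$.
   Context: $D(X)=\int p\log(p/\varphi_{a,\sigma})$ is the relative entropy of $X$ (with density $p$, mean $a$, variance $\sigma^2$) with respect to the normal law $N(a,\sigma^2)$ with density $\varphi_{a,\sigma}$. *)

theory Defs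
  imports "HOL-Probability.Probability"
begin

definition has_density_real :: "real measure \<Rightarrow> (real \<Rightarrow> real) \<Rightarrow> bool" where
  "has_density_real \<mu> p \<longleftrightarrow>
     p \<in> borel_measurable lborel \<and> (\<forall>x. 0 \<le> p x) \<and> \<mu> = density lborel (\<lambda>x. ennreal (p x))"

text \<open>Relative entropy D of a law with respect to the normal law with the same mean and
  variance: the integral of p log(p / phi_{a,sigma}).  It is +infinity if the law has no
  density or the integrand is not Lebesgue integrable (its negative part is always integrable
  under a finite second moment, so non-integrability means the integral is +infinity).\<close>
definition gauss_rel_entropy :: "real measure \<Rightarrow> ereal" where
  "gauss_rel_entropy \<mu> =
    (if \<exists>p. has_density_real \<mu> p then
       (let p = (SOME p. has_density_real \<mu> p);
            a = (\<integral>x. x \<partial>\<mu>);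
            \<sigma> = sqrt (\<integral>x. (x - a)\<^sup>2 \<partial>\<mu>);
            f = (\<lambda>x. p x * ln (p x / normal_density a \<sigma> x))
        in if integrable lborel f then ereal (\<integral>x. f x \<partial>lborel) else \<infinity>)
     else \<infinity>)"

end

theory Submission
  imports Defs "HOL-Real_Asymp.Real_Asymp"
begin

text \<open>
  The summands have tail \<open>P(X > u) \<approx> u\<^bsup>-s\<^esup> (ln u)\<^bsup>-h\<^esup>\<close> with \<open>1 < h < \<eta>\<close>, which just keeps the
  moment of order \<open>s\<close> finite. On the half-line beyond \<open>T = 2 \<surd>(ln n)\<close> the normal law has mass at
  most \<open>n\<^bsup>-2\<^esup>\<close>, whereas a single large summand makes \<open>Z\<^sub>n\<close> exceed \<open>T\<close> with probability of order
  \<open>n P(X > 3 \<surd>(n ln n))\<close>. On that event the likelihood ratio contributes a factor of order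
  \<open>ln n\<close>, so \<open>D(Z\<^sub>n)\<close> is at least of order \<open>(n ln n)\<^bsup>-(s-2)/2\<^esup> (ln n)\<^bsup>-h\<^esup>\<close>. Since \<open>h < \<eta>\<close>, all
  constants are absorbed for large \<open>n\<close>, and \<open>c(\<eta>) = 1\<close> works.
\<close>

section \<open>The borderline integral that decides the moment of order \<open>s\<close>\<close>

text \<open>An antiderivative is \<open>- (ln x powr (1 - h)) / (h - 1)\<close>, which vanishes at
  infinity exactly because \<open>h > 1\<close>. Up to a constant, this integrand is what the later
  heavy-tailed density becomes after multiplication by \<open>x powr s\<close>.\<close>

lemma integrable_inverse_ln_powr:
  fixes h :: real
  assumes h: "h > 1"
  shows "integrable lborel (\<lambda>x::real. indicator {exp 1..} x * (1 / (x * ln x powr h)))"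
proof -
  let ?F = "\<lambda>x::real. - (ln x powr (1 - h)) / (h - 1)"
  have lim: "(?F \<longlongrightarrow> 0) at_top"
    using h by real_asymp
  have "(\<integral>\<^sup>+x. ennreal (1 / (x * ln x powr h)) * indicator {exp 1..} x \<partial>lborel)
      = ennreal (0 - ?F (exp 1))"
  proof (rule nn_integral_FTC_atLeast[OF _ _ _ lim])
    fix x :: real assume x: "exp 1 \<le> x"
    then have x0: "x > 0" using exp_gt_zero[of "1::real"] by linarith
    then have l: "ln x > 0" using x ln_ge_iff[of x 1] by linarith
    show "DERIV ?F x :> 1 / (x * ln x powr h)"
    proof -
      have "DERIV (\<lambda>x. ln x powr (1 - h)) x :> (1 - h) * ln x powr (1 - h - of_nat 1) * (1 / x)"
        using x0 l by (intro DERIV_fun_powr) (auto intro!: derivative_eq_intros)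
      from DERIV_cdivide[OF DERIV_minus[OF this], of "h - 1"]
      have "DERIV ?F x :> - ((1 - h) * ln x powr (1 - h - of_nat 1) * (1 / x)) / (h - 1)" .
      moreover have "- ((1 - h) * ln x powr (1 - h - of_nat 1) * (1 / x)) / (h - 1)
          = 1 / (x * ln x powr h)"
        using x0 h l by (simp add: powr_minus divide_simps)
      ultimately show ?thesis by metis
    qed
    show "0 \<le> 1 / (x * ln x powr h)" using x0 by simp
  qed measurable
  then have fin: "(\<integral>\<^sup>+x. ennreal (indicator {exp 1..} x * (1 / (x * ln x powr h))) \<partial>lborel) < \<infinity>"
    by (subst nn_integral_cong[where v = "\<lambda>x. ennreal (1 / (x * ln x powr h)) * indicator {exp 1..} x"])
      (auto split: split_indicator)
  show ?thesis
  proof (rule integrableI_nonneg[OF _ _ fin])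
    show "AE x::real in lborel. 0 \<le> indicator {exp 1..} x * (1 / (x * ln x powr h))"
    proof (rule AE_I2)
      fix x :: real
      show "0 \<le> indicator {exp 1..} x * (1 / (x * ln x powr h))"
        using exp_gt_zero[of "1::real"] by (cases "exp 1 \<le> x") (auto simp del: exp_gt_zero)
    qed
  qed measurable
qed

section \<open>Relative entropy: a finiteness criterion and a lower bound from the tail\<close>

text \<open>Both \<open>ln p\<close> and the logarithm of the normal density grow at most
  quadratically, so the entropy integrand is dominated by \<open>p\<close> times a quadratic
  polynomial, which the second moment makes integrable.\<close>

lemma gauss_rel_entropy_finite:
  fixes p :: "real \<Rightarrow> real"
  assumes p: "has_density_real \<mu> p"
    and prob: "prob_space \<mu>"
    and sq: "integrable \<mu> (\<lambda>x. x\<^sup>2)"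
    and mean: "(\<integral>x. x \<partial>\<mu>) = 0" and var: "(\<integral>x. x\<^sup>2 \<partial>\<mu>) = 1"
    and ln_p: "\<And>x. p x > 0 \<Longrightarrow> \<bar>ln (p x)\<bar> \<le> a + b * x\<^sup>2"
  shows "gauss_rel_entropy \<mu> < \<infinity>"
proof -
  \<comment> \<open>The entropy is computed with a density picked by \<open>SOME\<close>. Densities
    of a finite measure agree almost everywhere, so integrability can be proved for \<open>p\<close>
    and transferred to \<open>q\<close>.\<close>
  define q where "q = (SOME p. has_density_real \<mu> p)"
  have q: "has_density_real \<mu> q"
    unfolding q_def using p by (metis someI)
  have [measurable]: "p \<in> borel_measurable borel" "q \<in> borel_measurable borel"
    and nn: "\<And>x. 0 \<le> p x" "\<And>x. 0 \<le> q x"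
    and mu: "\<mu> = density lborel p" "\<mu> = density lborel q"
    using p q by (auto simp: has_density_real_def)
  have mass: "(\<integral>\<^sup>+x. ennreal (p x) \<partial>lborel) = 1"
    using prob_space.emeasure_space_1[OF prob] unfolding mu(1)
    by (simp add: emeasure_density)
  have "density lborel (\<lambda>x. ennreal (p x)) = density lborel (\<lambda>x. ennreal (q x))"
    using mu by simp
  then have "AE x in lborel. ennreal (p x) = ennreal (q x)"
    by (subst (asm) finite_density_unique) (auto simp: mass)
  then have eq: "AE x in lborel. p x = q x"
    by eventually_elim (simp add: nn)
  have ip: "integrable lborel p"
    using mass nn by (intro integrableI_nonneg) auto
  have isq: "integrable lborel (\<lambda>x. p x * x\<^sup>2)"
    using sq unfolding mu(1) by (subst (asm) integrable_density) (auto simp: nn)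
  let ?f = "\<lambda>p x. p x * ln (p x / std_normal_density x)"
  have "integrable lborel (?f p)"
  proof (rule Bochner_Integration.integrable_bound)
    show "integrable lborel (\<lambda>x. (a + ln (sqrt (2 * pi))) * p x + (b + 1/2) * (p x * x\<^sup>2))"
      using ip isq by simp
    have "norm (?f p x) \<le> norm ((a + ln (sqrt (2 * pi))) * p x + (b + 1/2) * (p x * x\<^sup>2))" for x
    proof (cases "p x = 0")
      case False
      then have px: "p x > 0" using nn(1)[of x] by simp
      have "ln (std_normal_density x) = - ln (sqrt (2 * pi)) - x\<^sup>2 / 2"
        by (simp add: std_normal_density_def ln_mult ln_div)
      then have "ln (p x / std_normal_density x) = ln (p x) + ln (sqrt (2 * pi)) + x\<^sup>2 / 2"
        using px normal_density_pos[of 1 0 x] by (simp add: ln_div del: normal_density_pos)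
      moreover have "0 \<le> ln (sqrt (2 * pi))"
        using pi_ge_two by (intro ln_ge_zero) (simp add: real_le_rsqrt)
      moreover have "0 \<le> x\<^sup>2 / 2" by simp
      ultimately have "\<bar>ln (p x / std_normal_density x)\<bar>
          \<le> a + ln (sqrt (2 * pi)) + (b + 1/2) * x\<^sup>2"
        using ln_p[OF px] unfolding distrib_right by linarith
      then have "norm (?f p x) \<le> p x * (a + ln (sqrt (2 * pi)) + (b + 1/2) * x\<^sup>2)"
        using px by (simp add: abs_mult)
      also have "\<dots> = (a + ln (sqrt (2 * pi))) * p x + (b + 1/2) * (p x * x\<^sup>2)"
        by (simp add: algebra_simps)
      finally show ?thesis by simp
    qed simp
    then show "AE x in lborel. norm (?f p x)
        \<le> norm ((a + ln (sqrt (2 * pi))) * p x + (b + 1/2) * (p x * x\<^sup>2))"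
      by simp
  qed measurable
  moreover have "integrable lborel (?f p) \<longleftrightarrow> integrable lborel (?f q)"
    using eq by (intro integrable_cong_AE) (auto elim: eventually_mono)
  ultimately have "integrable lborel (?f q)" by simp
  then show ?thesis
    using p unfolding gauss_rel_entropy_def
    by (auto simp: Let_def mean var q_def[symmetric])
qed

text \<open>Chernoff's argument: \<open>x\<^sup>2 \<ge> T\<^sup>2 + (x - T)\<^sup>2\<close> on the half-line \<open>x \<ge> T \<ge> 0\<close>.\<close>
lemma std_normal_tail_le:
  assumes T: "0 \<le> T"
  shows "(\<integral>x. indicator {T<..} x * std_normal_density x \<partial>lborel) \<le> exp (- T\<^sup>2 / 2)"
proof -
  have int: "integrable lborel (normal_density T 1)"
    by (rule integrable_normal_density) simp
  have "(\<integral>x. indicator {T<..} x * std_normal_density x \<partial>lborel)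
      \<le> (\<integral>x. exp (- T\<^sup>2 / 2) * normal_density T 1 x \<partial>lborel)"
  proof (rule integral_mono_AE)
    show "integrable lborel (\<lambda>x. indicator {T<..} x * std_normal_density x)"
      by (rule integrable_mult_indicator[of _ lborel "std_normal_density", simplified])
        (auto intro: integrable_normal_density)
    show "integrable lborel (\<lambda>x. exp (- T\<^sup>2 / 2) * normal_density T 1 x)"
      using int by simp
    show "AE x in lborel. indicator {T<..} x * std_normal_density x
        \<le> exp (- T\<^sup>2 / 2) * normal_density T 1 x"
    proof (rule AE_I2)
      fix x :: real
      show "indicator {T<..} x * std_normal_density x \<le> exp (- T\<^sup>2 / 2) * normal_density T 1 x"
      proof (cases "T < x")
        case True
        have "T * (x - T) \<ge> 0" using T True by simp
        then have "- x\<^sup>2 / 2 \<le> - T\<^sup>2 / 2 + - (x - T)\<^sup>2 / 2"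
          by (simp add: power2_eq_square algebra_simps)
        then have "exp (- x\<^sup>2 / 2) \<le> exp (- T\<^sup>2 / 2) * exp (- (x - T)\<^sup>2 / 2)"
          by (simp only: exp_add[symmetric] exp_le_cancel_iff)
        then show ?thesis using True
          by (simp add: normal_density_def divide_right_mono)
      qed (simp add: normal_density_nonneg)
    qed
  qed
  also have "\<dots> = exp (- T\<^sup>2 / 2)"
    by (simp add: integral_normal_density)
  finally show ?thesis .
qed

text \<open>With \<open>\<phi>\<close> the normal density, integrate \<open>p ln (p / \<phi>) \<ge> p ln l + p - l \<phi>\<close>, taking
  \<open>l = r\<close> on the tail and \<open>l = 1\<close> elsewhere.\<close>
lemma gauss_rel_entropy_ge_tail:
  assumes prob: "prob_space \<mu>"
    and mean: "(\<integral>x. x \<partial>\<mu>) = 0" and var: "(\<integral>x. x\<^sup>2 \<partial>\<mu>) = 1"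
    and T: "0 \<le> T" and lam: "r > 0"
  shows "ereal (measure \<mu> {T<..} * ln r - r * exp (- T\<^sup>2 / 2)) \<le> gauss_rel_entropy \<mu>"
proof (cases "\<exists>p. has_density_real \<mu> p")
  \<comment> \<open>Without a density, or with a non-integrable integrand, the entropy is infinite
    and the bound is trivial; the work lies in the remaining case.\<close>
  case True
  define q where "q = (SOME p. has_density_real \<mu> p)"
  have q: "has_density_real \<mu> q"
    unfolding q_def using True by (rule someI_ex)
  have [measurable]: "q \<in> borel_measurable borel"
    and nn: "\<And>x. 0 \<le> q x" and mu: "\<mu> = density lborel q"
    using q by (auto simp: has_density_real_def)
  have mass: "(\<integral>\<^sup>+x. ennreal (q x) \<partial>lborel) = 1"
    using prob_space.emeasure_space_1[OF prob] unfolding mu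
    by (simp add: emeasure_density)
  have iq: "integrable lborel q"
    using mass nn by (intro integrableI_nonneg) auto
  have one: "(\<integral>x. q x \<partial>lborel) = 1"
    using mass nn by (simp add: integral_eq_nn_integral)
  let ?f = "\<lambda>x. q x * ln (q x / std_normal_density x)"
  let ?A = "{T<..}"
  let ?phi = "std_normal_density"
  have D: "gauss_rel_entropy \<mu> = (if integrable lborel ?f then ereal (\<integral>x. ?f x \<partial>lborel) else \<infinity>)"
    using True unfolding gauss_rel_entropy_def
    by (simp add: Let_def mean var q_def[symmetric])
  have tail: "measure \<mu> ?A = (\<integral>x. indicator ?A x * q x \<partial>lborel)"
  proof -
    have "emeasure \<mu> ?A = (\<integral>\<^sup>+x. ennreal (indicator ?A x * q x) \<partial>lborel)"
      unfolding mu by (subst emeasure_density) (auto intro!: nn_integral_cong split: split_indicator)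
    then show ?thesis
      by (simp add: measure_def integral_eq_nn_integral nn)
  qed
  have iphi: "integrable lborel ?phi"
    by (rule integrable_normal_density) simp
  have iAq: "integrable lborel (\<lambda>x. indicator ?A x * q x)"
    using integrable_mult_indicator[of ?A lborel q] iq by simp
  have iAphi: "integrable lborel (\<lambda>x. indicator ?A x * ?phi x)"
    using integrable_mult_indicator[of ?A lborel ?phi] iphi by simp
  show ?thesis
  proof (cases "integrable lborel ?f")
    case int: True
    \<comment> \<open>This is \<open>ln y <= y - 1\<close> at \<open>y = l * phi / q\<close>,
      multiplied by \<open>q\<close>.\<close>
    have key: "q x * ln l + q x - l * ?phi x \<le> ?f x" if l: "l > 0" for l x
    proof (cases "q x = 0")
      case False
      then have qx: "q x > 0" using nn[of x] by simp
      have ph: "?phi x > 0" by (simp add: normal_density_pos)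
      have "ln (l * ?phi x / q x) \<le> l * ?phi x / q x - 1"
        using l qx ph by (intro ln_le_minus_one) simp
      moreover have "ln (l * ?phi x / q x) = ln l - ln (q x / ?phi x)"
        using l qx ph by (simp add: ln_mult ln_div)
      ultimately have "q x * (ln l - ln (q x / ?phi x)) \<le> q x * (l * ?phi x / q x - 1)"
        using qx by simp
      then show ?thesis using qx by (simp add: algebra_simps)
    qed (use l in \<open>simp add: normal_density_nonneg\<close>)
    \<comment> \<open>One formula for the lower bound of \<open>key\<close> with
      \<open>l = r\<close> on \<open>?A\<close> and \<open>l = 1\<close> off it. The terms
      \<open>q\<close> and \<open>phi\<close> both integrate to 1 and cancel, leaving only tail
      quantities.\<close>
    let ?g = "\<lambda>x. ln r * (indicator ?A x * q x) + q x - ?phi x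
        - (r - 1) * (indicator ?A x * ?phi x)"
    have ig: "integrable lborel ?g"
      using iAq iAphi iq iphi by simp
    have "(\<integral>x. ?g x \<partial>lborel) \<le> (\<integral>x. ?f x \<partial>lborel)"
    proof (rule integral_mono[OF ig int])
      fix x
      show "?g x \<le> ?f x"
        using key[OF lam, of x] key[of 1 x] by (cases "x \<in> ?A") (auto simp: algebra_simps)
    qed
    moreover have "(\<integral>x. ?g x \<partial>lborel) = ln r * measure \<mu> ?A
        - (r - 1) * (\<integral>x. indicator ?A x * ?phi x \<partial>lborel)"
      using iAq iAphi iq iphi by (simp add: tail one integral_normal_density)
    moreover have "(r - 1) * (\<integral>x. indicator ?A x * ?phi x \<partial>lborel) \<le> r * exp (- T\<^sup>2 / 2)"
    proof -
      have "0 \<le> (\<integral>x. indicator ?A x * ?phi x \<partial>lborel)"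
        by (intro integral_nonneg_AE AE_I2) (simp add: normal_density_nonneg)
      then have "(r - 1) * (\<integral>x. indicator ?A x * ?phi x \<partial>lborel)
          \<le> r * (\<integral>x. indicator ?A x * ?phi x \<partial>lborel)"
        by (simp add: algebra_simps)
      also have "\<dots> \<le> r * exp (- T\<^sup>2 / 2)"
        using std_normal_tail_le[OF T] lam by simp
      finally show ?thesis .
    qed
    ultimately show ?thesis
      using int unfolding D by (simp add: mult.commute)
  qed (simp add: D)
qed (simp add: gauss_rel_entropy_def)

section \<open>Sums of independent centred variables with unit variance\<close>

context prob_space
begin

text \<open>Independence and centring make the cross term vanish at each induction step. The
  integrability claims are carried along because the product rule for expectations needs
  them.\<close>

lemma indep_sum_second_moment:
  fixes X :: "'i \<Rightarrow> 'a \<Rightarrow> real"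
  assumes "finite I" "indep_vars (\<lambda>_. borel) X I"
    and "\<And>i. i \<in> I \<Longrightarrow> integrable M (\<lambda>\<omega>. (X i \<omega>)\<^sup>2)"
    and "\<And>i. i \<in> I \<Longrightarrow> expectation (X i) = 0"
    and "\<And>i. i \<in> I \<Longrightarrow> expectation (\<lambda>\<omega>. (X i \<omega>)\<^sup>2) = 1"
  shows "integrable M (\<lambda>\<omega>. \<Sum>i\<in>I. X i \<omega>)" "expectation (\<lambda>\<omega>. \<Sum>i\<in>I. X i \<omega>) = 0"
    "integrable M (\<lambda>\<omega>. (\<Sum>i\<in>I. X i \<omega>)\<^sup>2)"
    "expectation (\<lambda>\<omega>. (\<Sum>i\<in>I. X i \<omega>)\<^sup>2) = card I"
proof -
  have "integrable M (\<lambda>\<omega>. \<Sum>i\<in>I. X i \<omega>) \<and> expectation (\<lambda>\<omega>. \<Sum>i\<in>I. X i \<omega>) = 0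
    \<and> integrable M (\<lambda>\<omega>. (\<Sum>i\<in>I. X i \<omega>)\<^sup>2)
    \<and> expectation (\<lambda>\<omega>. (\<Sum>i\<in>I. X i \<omega>)\<^sup>2) = card I"
    using assms
  proof (induction I rule: finite_induct)
    case (insert i I)
    let ?S = "\<lambda>\<omega>. \<Sum>i\<in>I. X i \<omega>"
    have IH: "integrable M ?S" "expectation ?S = 0" "integrable M (\<lambda>\<omega>. (?S \<omega>)\<^sup>2)"
      "expectation (\<lambda>\<omega>. (?S \<omega>)\<^sup>2) = card I"
      using insert.IH[OF indep_vars_subset[OF insert.prems(1)]] insert.prems by auto
    have ind: "indep_var borel (X i) borel ?S"
      by (rule indep_vars_sum[OF insert.hyps(1,2) insert.prems(1)])
    have [measurable]: "X i \<in> borel_measurable M"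
      using insert.prems(1) unfolding indep_vars_def by blast
    have iX: "integrable M (X i)"
      using insert.prems(2)[of i] by (rule square_integrable_imp_integrable[rotated]) auto
    have prod: "integrable M (\<lambda>\<omega>. X i \<omega> * ?S \<omega>)" "expectation (\<lambda>\<omega>. X i \<omega> * ?S \<omega>) = 0"
      using indep_var_integrable[OF ind iX IH(1)] indep_var_lebesgue_integral[OF ind iX IH(1)] IH(2)
      by auto
    have eq: "(\<lambda>\<omega>. (\<Sum>j\<in>insert i I. X j \<omega>)\<^sup>2)
        = (\<lambda>\<omega>. (X i \<omega>)\<^sup>2 + 2 * (X i \<omega> * ?S \<omega>) + (?S \<omega>)\<^sup>2)"
      using insert.hyps by (simp add: power2_sum algebra_simps)
    show ?case
      unfolding eq using insert.hyps iX IH prod insert.prems(2)[of i] insert.prems(3)[of i]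
        insert.prems(4)[of i] by simp
  qed simp
  then show "integrable M (\<lambda>\<omega>. \<Sum>i\<in>I. X i \<omega>)" "expectation (\<lambda>\<omega>. \<Sum>i\<in>I. X i \<omega>) = 0"
    "integrable M (\<lambda>\<omega>. (\<Sum>i\<in>I. X i \<omega>)\<^sup>2)"
    "expectation (\<lambda>\<omega>. (\<Sum>i\<in>I. X i \<omega>)\<^sup>2) = card I"
    by auto
qed

text \<open>The events that \<open>X\<^sub>i\<close> alone exceeds \<open>v\<close> while the other summands add up to more than
  \<open>- 2 \<surd>n\<close> are disjoint; by independence and Chebyshev each has probability at least \<open>q / 2\<close>.\<close>
lemma indep_sum_one_big_jump:
  fixes X :: "'i \<Rightarrow> 'a \<Rightarrow> real" and v q :: real
  assumes fin: "finite I" and ind: "indep_vars (\<lambda>_. borel) X I"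
    and sq: "\<And>i. i \<in> I \<Longrightarrow> integrable M (\<lambda>\<omega>. (X i \<omega>)\<^sup>2)"
    and mean: "\<And>i. i \<in> I \<Longrightarrow> expectation (X i) = 0"
    and var: "\<And>i. i \<in> I \<Longrightarrow> expectation (\<lambda>\<omega>. (X i \<omega>)\<^sup>2) = 1"
    and tail: "\<And>i. i \<in> I \<Longrightarrow> prob {\<omega>\<in>space M. X i \<omega> > v} = q"
    and v: "v \<ge> 2 * sqrt (card I)"
  shows "card I * q / 2 \<le> prob {\<omega>\<in>space M. (\<Sum>i\<in>I. X i \<omega>) > v - 2 * sqrt (card I)}"
proof (cases "I = {}")
  case False
  let ?n = "real (card I)"
  have n: "?n \<ge> 1" using False fin by (simp add: Suc_le_eq card_gt_0_iff)
  then have v0: "v > 0" using v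
    by (smt (verit) real_sqrt_ge_one)
  have [measurable]: "X i \<in> borel_measurable M" if "i \<in> I" for i
    using ind that unfolding indep_vars_def by blast
  have q0: "q \<ge> 0" 
  proof -
    obtain i where "i \<in> I" using False by auto
    then show ?thesis using tail[of i] measure_nonneg[of M "{\<omega>\<in>space M. X i \<omega> > v}"] by linarith
  qed
  \<comment> \<open>Chebyshev gives \<open>q <= 1 / v^2\<close>, and \<open>v^2 >= 4 n\<close>. This
    makes simultaneous large values of two summands cheap to discard.\<close>
  have q4: "?n * q \<le> 1 / 4"
  proof -
    obtain i where i: "i \<in> I" using False by auto
    have "q = prob {\<omega>\<in>space M. X i \<omega> > v}" using tail i by simp
    also have "\<dots> \<le> prob {\<omega>\<in>space M. \<bar>X i \<omega> - expectation (X i)\<bar> \<ge> v}"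
      using i mean by (intro finite_measure_mono) auto
    also have "\<dots> \<le> variance (X i) / v\<^sup>2"
      using i sq v0 by (intro Chebyshev_inequality) auto
    also have "\<dots> = 1 / v\<^sup>2"
      using i mean var by simp
    finally have "?n * q \<le> ?n * (1 / v\<^sup>2)" using n by (intro mult_left_mono) auto
    moreover have "(2 * sqrt ?n)\<^sup>2 \<le> v\<^sup>2"
      using v by (intro power_mono) auto
    then have "?n * (1 / v\<^sup>2) \<le> 1 / 4" using v0 by (simp add: power_mult_distrib field_simps)
    ultimately show ?thesis by linarith
  qed
  define S where "S i \<omega> = (\<Sum>j\<in>I - {i}. X j \<omega>)" for i \<omega>
  define E where "E i = {\<omega>\<in>space M. X i \<omega> > v}" for i
  define B where "B i = {\<omega>\<in>space M. X i \<omega> > v \<and> S i \<omega> > - 2 * sqrt ?n}" for i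
  \<comment> \<open>Removing the points where a second summand also exceeds \<open>v\<close> turns
    the overlapping events \<open>B i\<close> into disjoint ones.\<close>
  define C where "C i = B i - (\<Union>j\<in>I - {i}. E i \<inter> E j)" for i
  have [measurable]: "S i \<in> borel_measurable M" for i
    unfolding S_def by measurable
  have [measurable]: "E i \<in> sets M" "B i \<in> sets M" if "i \<in> I" for i
    using that unfolding E_def B_def by measurable
  have C_sets: "C i \<in> sets M" if "i \<in> I" for i
    using that fin unfolding C_def by (intro sets.Diff sets.finite_UN) auto
  have indS: "indep_var borel (X i) borel (S i)" if "i \<in> I" for i
    unfolding S_def using fin that ind by (intro indep_vars_sum) (auto simp: insert_absorb)
  \<comment> \<open>Pairwise independence is read off from the sum rule, with \<open>X j\<close> as
    a one-term sum.\<close>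
  have indX: "indep_var borel (X i) borel (X j)" if "i \<in> I" "j \<in> I" "i \<noteq> j" for i j
    using indep_vars_sum[of "{j}" i X] indep_vars_subset[OF ind, of "{i, j}"] that by simp
  have EE: "prob (E i \<inter> E j) = q\<^sup>2" if ij: "i \<in> I" "j \<in> I" "i \<noteq> j" for i j
  proof -
    have "E i \<inter> E j = (\<lambda>x. (X i x, X j x)) -` ({v<..} \<times> {v<..}) \<inter> space M"
      by (auto simp: E_def)
    then have "prob (E i \<inter> E j) = prob (X i -` {v<..} \<inter> space M) * prob (X j -` {v<..} \<inter> space M)"
      using indep_varD[OF indX[OF ij], of "{v<..}" "{v<..}"] by simp
    also have "\<dots> = q * q"
      using tail[of i] tail[of j] ij by (simp add: vimage_def Int_def conj_commute)
    finally show ?thesis by (simp add: power2_eq_square)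
  qed
  \<comment> \<open>The other \<open>n - 1\<close> summands have total variance below
    \<open>n\<close>, so their sum stays above \<open>- 2 * sqrt n\<close> with probability at least
    3/4; independence of \<open>X i\<close> and \<open>S i\<close> supplies the factor
    \<open>q\<close>.\<close>
  have PB: "prob (B i) \<ge> q * (3 / 4)" if i: "i \<in> I" for i
  proof -
    have mom: "integrable M (S i)" "expectation (S i) = 0" "integrable M (\<lambda>\<omega>. (S i \<omega>)\<^sup>2)"
      "expectation (\<lambda>\<omega>. (S i \<omega>)\<^sup>2) = card (I - {i})"
      using indep_sum_second_moment[of "I - {i}" X] fin sq mean var indep_vars_subset[OF ind, of "I - {i}"]
      unfolding S_def by auto
    have "prob {\<omega>\<in>space M. \<bar>S i \<omega> - expectation (S i)\<bar> \<ge> 2 * sqrt ?n} \<le> variance (S i) / (2 * sqrt ?n)\<^sup>2"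
      using mom n by (intro Chebyshev_inequality) auto
    also have "\<dots> \<le> 1 / 4"
      using mom n i fin by (simp add: power_mult_distrib)
    finally have c: "prob {\<omega>\<in>space M. \<bar>S i \<omega>\<bar> \<ge> 2 * sqrt ?n} \<le> 1 / 4"
      by (simp add: mom)
    let ?G = "{\<omega>\<in>space M. \<not> \<bar>S i \<omega>\<bar> \<ge> 2 * sqrt ?n}"
    have "3 / 4 \<le> 1 - prob {\<omega>\<in>space M. \<bar>S i \<omega>\<bar> \<ge> 2 * sqrt ?n}" using c by simp
    also have "\<dots> = prob ?G" by (subst prob_neg) auto
    also have "\<dots> \<le> prob (S i -` {- 2 * sqrt ?n<..} \<inter> space M)"
      by (intro finite_measure_mono) auto
    finally have "q * (3 / 4) \<le> q * prob (S i -` {- 2 * sqrt ?n<..} \<inter> space M)"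
      using q0 by (intro mult_left_mono)
    also have "\<dots> = prob (X i -` {v<..} \<inter> space M) * prob (S i -` {- 2 * sqrt ?n<..} \<inter> space M)"
      using tail[OF i] by (simp add: vimage_def Int_def conj_commute)
    also have "\<dots> = prob ((\<lambda>x. (X i x, S i x)) -` ({v<..} \<times> {- 2 * sqrt ?n<..}) \<inter> space M)"
      by (rule indep_varD[OF indS[OF i], symmetric]) auto
    also have "(\<lambda>x. (X i x, S i x)) -` ({v<..} \<times> {- 2 * sqrt ?n<..}) \<inter> space M = B i"
      by (auto simp: B_def)
    finally show ?thesis .
  qed
  \<comment> \<open>A union bound over the other indices costs at most
    \<open>n * q^2 <= q / 4\<close>, which reduces 3/4 to 1/2.\<close>
  have PC: "q / 2 \<le> prob (C i)" if i: "i \<in> I" for i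
  proof -
    have U: "(\<Union>j\<in>I - {i}. E i \<inter> E j) \<in> sets M"
      using fin i by (intro sets.finite_UN) auto
    have "prob (\<Union>j\<in>I - {i}. E i \<inter> E j) \<le> (\<Sum>j\<in>I - {i}. prob (E i \<inter> E j))"
      using fin i by (intro finite_measure_subadditive_finite) auto
    also have "\<dots> = (\<Sum>j\<in>I - {i}. q\<^sup>2)"
      using i by (intro sum.cong) (auto simp: EE)
    also have "\<dots> = card (I - {i}) * q\<^sup>2" by simp
    also have "\<dots> \<le> ?n * q\<^sup>2"
      using fin by (intro mult_right_mono) (auto intro: card_mono)
    also have "\<dots> = q * (?n * q)" by (simp add: power2_eq_square)
    also have "\<dots> \<le> q * (1 / 4)" using q4 q0 by (intro mult_left_mono)
    finally have "prob (\<Union>j\<in>I - {i}. E i \<inter> E j) \<le> q * (1 / 4)" .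
    moreover have "prob (B i) \<le> prob (C i \<union> (\<Union>j\<in>I - {i}. E i \<inter> E j))"
      using i U C_sets by (intro finite_measure_mono) (auto simp: C_def)
    moreover have "\<dots> \<le> prob (C i) + prob (\<Union>j\<in>I - {i}. E i \<inter> E j)"
      using i U C_sets by (intro measure_Un_le) auto
    ultimately show ?thesis using PB[OF i] by linarith
  qed
  have disj: "disjoint_family_on C I"
    unfolding disjoint_family_on_def C_def B_def E_def by auto
  have "?n * q / 2 = (\<Sum>i\<in>I. q / 2)" by simp
  also have "\<dots> \<le> (\<Sum>i\<in>I. prob (C i))" by (intro sum_mono PC)
  also have "\<dots> = prob (\<Union>i\<in>I. C i)"
    using fin C_sets disj by (intro finite_measure_finite_Union[symmetric]) auto
  also have "\<dots> \<le> prob {\<omega>\<in>space M. (\<Sum>i\<in>I. X i \<omega>) > v - 2 * sqrt ?n}"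
  proof (rule finite_measure_mono)
    show "(\<Union>i\<in>I. C i) \<subseteq> {\<omega>\<in>space M. (\<Sum>i\<in>I. X i \<omega>) > v - 2 * sqrt ?n}"
    proof
      fix \<omega> assume "\<omega> \<in> (\<Union>i\<in>I. C i)"
      then obtain i where i: "i \<in> I" "\<omega> \<in> B i" by (auto simp: C_def)
      then have "(\<Sum>i\<in>I. X i \<omega>) = X i \<omega> + S i \<omega>"
        unfolding S_def using fin by (simp add: sum.remove)
      then show "\<omega> \<in> {\<omega>\<in>space M. (\<Sum>i\<in>I. X i \<omega>) > v - 2 * sqrt ?n}"
        using i by (auto simp: B_def)
    qed
  qed measurable
  finally show ?thesis .
qed simp

end

section \<open>The law of a single summand\<close>

text \<open>The witness is the law with density proportional to
  \<open>y powr (- s - 1) * ln y powr (- h)\<close> on the half-line from \<open>exp 1\<close>,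
  standardised by an affine map. The map changes the tail only by constants, and the logarithm of
  the density grows slowly enough for finite entropy.\<close>

lemma heavy_tail_law:
  fixes s h :: real
  assumes s: "s > 2" and h: "h > 1"
  obtains \<mu> :: "real measure" and K u0 :: real
  where "prob_space \<mu>" "sets \<mu> = sets borel"
    "integrable \<mu> (\<lambda>x. x\<^sup>2)" "(\<integral>x. x \<partial>\<mu>) = 0" "(\<integral>x. x\<^sup>2 \<partial>\<mu>) = 1"
    "integrable \<mu> (\<lambda>x. \<bar>x\<bar> powr s)" "gauss_rel_entropy \<mu> < \<infinity>" "K > 0"
    "\<And>u. u \<ge> u0 \<Longrightarrow> K * (u powr (- s) * ln u powr (- h)) \<le> measure \<mu> {u<..}"
proof -
  define e :: real where "e = exp 1"
  have e: "e > 1" by (simp add: e_def)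
  have ln_e: "ln y \<ge> 1" if "y \<ge> e" for y
    using that e ln_ge_iff[of y 1] unfolding e_def by linarith
  \<comment> \<open>Starting the support at \<open>exp 1\<close> keeps \<open>ln y >= 1\<close>. The
    function \<open>G\<close> is \<open>f0\<close> weighted by \<open>y powr s\<close>.\<close>
  define f0 where "f0 y = indicator {e..} y * (y powr (- s - 1) * ln y powr (- h))" for y :: real
  define G where "G y = indicator {e..} y * (1 / (y * ln y powr h))" for y :: real
  have G: "integrable lborel G"
    using integrable_inverse_ln_powr[OF h] by (simp add: G_def[abs_def] e_def)
  have [measurable]: "f0 \<in> borel_measurable borel"
    unfolding f0_def[abs_def] by measurable
  have f0_nn: "f0 y \<ge> 0" for y by (simp add: f0_def)
  have f0_G: "f0 y * y powr s = G y" for y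
  proof (cases "y \<ge> e")
    case True
    then have "y powr (- s - 1) * y powr s = 1 / y"
      using e by (simp add: powr_add[symmetric] powr_minus_divide)
    then show ?thesis using True
      by (simp add: f0_def G_def powr_minus_divide[of "ln y"] mult_ac)
  qed (simp add: f0_def G_def)
  \<comment> \<open>All moment conditions reduce to the one integral of \<open>G\<close>: any
    function bounded by a multiple of \<open>y powr s\<close> on the support is integrable against
    \<open>f0\<close>.\<close>
  have dom: "integrable lborel (\<lambda>y. f0 y * g y)"
    if [measurable]: "g \<in> borel_measurable borel" and g: "\<And>y. y \<ge> e \<Longrightarrow> \<bar>g y\<bar> \<le> B * y powr s" for g B
  proof (rule Bochner_Integration.integrable_bound)
    show "integrable lborel (\<lambda>y. B * G y)" using G by simp
    have "\<bar>f0 y * g y\<bar> \<le> \<bar>B * G y\<bar>" for y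
    proof (cases "y \<ge> e")
      case True
      have "\<bar>f0 y * g y\<bar> \<le> f0 y * (B * y powr s)"
        using g[OF True] f0_nn[of y] by (simp add: abs_mult mult_left_mono)
      also have "\<dots> = B * G y" by (simp add: f0_G[symmetric])
      finally show ?thesis by linarith
    qed (simp add: f0_def)
    then show "AE y in lborel. norm (f0 y * g y) \<le> norm (B * G y)" by simp
  qed measurable
  have one_le: "1 \<le> y powr s" "y\<^sup>2 \<le> y powr s" if "y \<ge> e" for y
  proof -
    show "1 \<le> y powr s" using that e s by (simp add: ge_one_powr_ge_zero)
    have "y powr 2 \<le> y powr s" using that e s by (intro powr_mono) auto
    then show "y\<^sup>2 \<le> y powr s" using that e by simp
  qed
  have int0: "integrable lborel f0"
    using dom[of "\<lambda>_. 1" 1] one_le by simp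
  have intA: "integrable lborel (\<lambda>y. indicator {w<..} y * f0 y)" for w
    using integrable_mult_indicator[of "{w<..}" lborel f0] int0 by simp
  \<comment> \<open>Only the stretch from \<open>w\<close> to \<open>2 * w\<close> is kept. There
    the decreasing density is at least its value at \<open>2 * w\<close>, and the length
    \<open>w\<close> turns \<open>(2 * w) powr (- s - 1)\<close> into half of
    \<open>(2 * w) powr (- s)\<close>.\<close>
  have tail0: "(2 * w) powr (- s) * ln (2 * w) powr (- h) / 2 \<le> (\<integral>y. indicator {w<..} y * f0 y \<partial>lborel)"
    if w: "w \<ge> e" for w
  proof -
    let ?c = "(2 * w) powr (- s - 1) * ln (2 * w) powr (- h)"
    have "(\<integral>y. indicator {w<..2*w} y * ?c \<partial>lborel) = w * ?c"
      using w e by simp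
    also have "\<dots> = (2 * w) powr (- s) * ln (2 * w) powr (- h) / 2"
      using w e by (simp add: powr_diff)
    finally have 1: "(\<integral>y. indicator {w<..2*w} y * ?c \<partial>lborel)
      = (2 * w) powr (- s) * ln (2 * w) powr (- h) / 2" .
    have "(\<integral>y. indicator {w<..2*w} y * ?c \<partial>lborel) \<le> (\<integral>y. indicator {w<..} y * f0 y \<partial>lborel)"
    proof (rule integral_mono[OF _ intA])
      show "integrable lborel (\<lambda>y. indicator {w<..2*w} y * ?c)"
        using w e by (intro integrable_mult_left) auto
      fix y :: real
      show "indicator {w<..2*w} y * ?c \<le> indicator {w<..} y * f0 y"
      proof (cases "w < y \<and> y \<le> 2 * w")
        case True
        have "(2 * w) powr (- s - 1) \<le> y powr (- s - 1)"
          using True w e s by (intro powr_mono2') auto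
        moreover have "ln (2 * w) powr (- h) \<le> ln y powr (- h)"
          using True w e h by (intro powr_mono2') auto
        ultimately show ?thesis using True w
          by (auto simp: f0_def intro!: mult_mono)
      qed (use f0_nn in auto)
    qed
    then show ?thesis unfolding 1 .
  qed
  define I0 where "I0 = (\<integral>y. f0 y \<partial>lborel)"
  have I0: "I0 > 0"
  proof -
    have "0 < (2 * e) powr (- s) * ln (2 * e) powr (- h) / 2"
      using e ln_e[of "2 * e"] by simp
    also have "\<dots> \<le> (\<integral>y. indicator {e<..} y * f0 y \<partial>lborel)" by (rule tail0) simp
    also have "\<dots> \<le> I0" unfolding I0_def
      by (rule integral_mono[OF intA int0]) (simp add: f0_nn split: split_indicator)
    finally show ?thesis .
  qed
  define f where "f y = f0 y / I0" for y
  have [measurable]: "f \<in> borel_measurable borel" unfolding f_def[abs_def] by measurable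
  have f_nn: "f y \<ge> 0" for y using f0_nn I0 by (simp add: f_def)
  have int_f: "integrable lborel f" using int0 by (simp add: f_def[abs_def])
  have f_one: "(\<integral>y. f y \<partial>lborel) = 1" using I0 by (simp add: f_def I0_def)
  define \<nu> where "\<nu> = density lborel (\<lambda>y. ennreal (f y))"
  have sets_nu[measurable_cong]: "sets \<nu> = sets borel" by (simp add: \<nu>_def)
  have "(\<integral>\<^sup>+y. ennreal (f y) \<partial>lborel) = 1"
    using int_f f_one f_nn by (subst nn_integral_eq_integral) auto
  then interpret nu: prob_space \<nu>
    by (intro prob_spaceI) (simp add: \<nu>_def emeasure_density)
  have int_nu: "integrable \<nu> g"
    if [measurable]: "g \<in> borel_measurable borel" and "\<And>y. y \<ge> e \<Longrightarrow> \<bar>g y\<bar> \<le> B * y powr s" for g B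
    unfolding \<nu>_def using dom[OF that] f_nn
    by (subst integrable_density) (auto simp: f_def)
  have meas_nu: "measure \<nu> {w<..} = (\<integral>y. indicator {w<..} y * f0 y \<partial>lborel) / I0" for w
  proof -
    have "measure \<nu> {w<..} = (\<integral>y. indicator {w<..} y \<partial>\<nu>)" by (simp add: \<nu>_def)
    also have "\<dots> = (\<integral>y. f y * indicator {w<..} y \<partial>lborel)"
      unfolding \<nu>_def by (subst integral_density) (auto simp: f_nn)
    also have "\<dots> = (\<integral>y. (indicator {w<..} y * f0 y) / I0 \<partial>lborel)"
      by (simp add: f_def mult.commute)
    finally show ?thesis by simp
  qed
  define m where "m = (\<integral>y. y \<partial>\<nu>)"
  have m0: "m \<ge> 0"
  proof -
    have "m = (\<integral>y. f y * y \<partial>lborel)"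
      unfolding m_def \<nu>_def by (subst integral_density) (auto simp: f_nn)
    also have "\<dots> \<ge> 0"
    proof (intro integral_nonneg_AE AE_I2)
      fix y show "0 \<le> f y * y"
        using I0 e by (cases "y \<ge> e") (auto simp: f_def f0_def)
    qed
    finally show ?thesis .
  qed
  have id_le: "\<bar>y\<bar> \<le> 1 * y powr s" if "y \<ge> e" for y
  proof -
    have "y * 1 \<le> y * y" using that e by (intro mult_left_mono) auto
    then have "y \<le> y powr s" using one_le(2)[OF that] unfolding power2_eq_square by linarith
    then show ?thesis using that e by simp
  qed
  have int_id: "integrable \<nu> (\<lambda>y. y)" by (rule int_nu[of _ 1]) (use id_le in auto)
  have int_sq: "integrable \<nu> (\<lambda>y. y\<^sup>2)" by (rule int_nu[of _ 1]) (use one_le in auto)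
  have int_c: "integrable \<nu> (\<lambda>y. (y - m)\<^sup>2)"
    using int_id int_sq by (simp add: power2_diff)
  define \<sigma> where "\<sigma> = sqrt (\<integral>y. (y - m)\<^sup>2 \<partial>\<nu>)"
  \<comment> \<open>Zero variance would concentrate the law at \<open>m\<close>, but a law with a
    density gives a single point no mass.\<close>
  have V: "(\<integral>y. (y - m)\<^sup>2 \<partial>\<nu>) > 0"
  proof (rule ccontr)
    assume "\<not> ?thesis"
    moreover have "(\<integral>y. (y - m)\<^sup>2 \<partial>\<nu>) \<ge> 0" by simp
    ultimately have "(\<integral>y. (y - m)\<^sup>2 \<partial>\<nu>) = 0" by linarith
    then have "AE y in \<nu>. (y - m)\<^sup>2 = 0"
      using int_c by (subst (asm) integral_nonneg_eq_0_iff_AE) auto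
    then have "AE y in lborel. 0 < ennreal (f y) \<longrightarrow> (y - m)\<^sup>2 = 0"
      unfolding \<nu>_def by (subst (asm) AE_density) auto
    then have "AE y in lborel. f y = 0"
      using AE_lborel_singleton[of m]
    proof eventually_elim
      case (elim y)
      then show ?case using f_nn[of y] by (cases "f y = 0") auto
    qed
    then have "(\<integral>y. f y \<partial>lborel) = 0" by (simp add: integral_eq_zero_AE)
    then show False using f_one by simp
  qed
  have sg: "\<sigma> > 0" and sg2: "\<sigma>\<^sup>2 = (\<integral>y. (y - m)\<^sup>2 \<partial>\<nu>)"
    using V by (auto simp: \<sigma>_def)
  define \<mu> where "\<mu> = distr \<nu> lborel (\<lambda>y. (y - m) / \<sigma>)"
  have prob: "prob_space \<mu>"
    unfolding \<mu>_def by (rule nu.prob_space_distr) measurable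
  have sets: "sets \<mu> = sets borel" by (simp add: \<mu>_def)
  have sq: "integrable \<mu> (\<lambda>x. x\<^sup>2)"
    unfolding \<mu>_def using int_c
    by (subst integrable_distr_eq) (auto simp: power_divide)
  have mean: "(\<integral>x. x \<partial>\<mu>) = 0"
  proof -
    have "(\<integral>x. x \<partial>\<mu>) = (\<integral>y. (y - m) / \<sigma> \<partial>\<nu>)"
      unfolding \<mu>_def by (rule integral_distr) measurable
    also have "\<dots> = ((\<integral>y. y \<partial>\<nu>) - m) / \<sigma>"
      using int_id nu.prob_space by simp
    finally show ?thesis by (simp add: m_def[symmetric])
  qed
  have var: "(\<integral>x. x\<^sup>2 \<partial>\<mu>) = 1"
  proof -
    have "(\<integral>x. x\<^sup>2 \<partial>\<mu>) = (\<integral>y. ((y - m) / \<sigma>)\<^sup>2 \<partial>\<nu>)"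
      unfolding \<mu>_def by (rule integral_distr) measurable
    also have "\<dots> = (\<integral>y. (y - m)\<^sup>2 \<partial>\<nu>) / \<sigma>\<^sup>2"
      by (simp add: power_divide)
    finally show ?thesis using sg by (simp add: sg2[symmetric])
  qed
  have abs_s: "integrable \<mu> (\<lambda>x. \<bar>x\<bar> powr s)"
  proof -
    have "integrable \<nu> (\<lambda>y. \<bar>(y - m) / \<sigma>\<bar> powr s)"
    \<comment> \<open>On the support \<open>y >= 1\<close> and \<open>m >= 0\<close>, so centring
      costs at most the factor \<open>1 + m\<close>; this explains the constant.\<close>
    proof (rule int_nu[of _ "((1 + m) / \<sigma>) powr s"])
      fix y assume y: "y \<ge> e"
      have "m * 1 \<le> m * y" using m0 y e by (intro mult_left_mono) auto
      then have "\<bar>y - m\<bar> \<le> (1 + m) * y"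
        using y e m0 by (simp add: algebra_simps abs_le_iff)
      then have "\<bar>(y - m) / \<sigma>\<bar> \<le> (1 + m) / \<sigma> * y"
        using sg by (simp add: divide_right_mono)
      then have "\<bar>(y - m) / \<sigma>\<bar> powr s \<le> ((1 + m) / \<sigma> * y) powr s"
        using s by (intro powr_mono2) auto
      also have "\<dots> = ((1 + m) / \<sigma>) powr s * y powr s"
        using sg m0 y e by (subst powr_mult) auto
      finally show "\<bar>\<bar>(y - m) / \<sigma>\<bar> powr s\<bar> \<le> ((1 + m) / \<sigma>) powr s * y powr s" by simp
    qed measurable
    then show ?thesis unfolding \<mu>_def by (subst integrable_distr_eq) auto
  qed
  define p where "p x = \<sigma> * f (\<sigma> * x + m)" for x
  have dens: "has_density_real \<mu> p"
  proof -
    have "distributed \<nu> lborel (\<lambda>y. y) (\<lambda>y. ennreal (f y))"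
      unfolding distributed_def by (auto simp: \<nu>_def intro!: distr_id2)
    from nu.distributed_affine[OF this, of "1 / \<sigma>" "- m / \<sigma>"]
    have "distr \<nu> lborel (\<lambda>y. - m / \<sigma> + 1 / \<sigma> * y)
        = density lborel (\<lambda>x. ennreal (f ((x - - m / \<sigma>) / (1 / \<sigma>))) / ennreal \<bar>1 / \<sigma>\<bar>)"
      using sg unfolding distributed_def by simp
    also have "(\<lambda>y. - m / \<sigma> + 1 / \<sigma> * y) = (\<lambda>y. (y - m) / \<sigma>)"
      by (auto simp: diff_divide_distrib)
    also have "(\<lambda>x. ennreal (f ((x - - m / \<sigma>) / (1 / \<sigma>))) / ennreal \<bar>1 / \<sigma>\<bar>) = (\<lambda>x. ennreal (p x))"
    proof
      fix x
      have "(x - - m / \<sigma>) / (1 / \<sigma>) = \<sigma> * x + m"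
        using sg by (simp add: field_simps)
      then show "ennreal (f ((x - - m / \<sigma>) / (1 / \<sigma>))) / ennreal \<bar>1 / \<sigma>\<bar> = ennreal (p x)"
        using sg f_nn[of "\<sigma> * x + m"] by (simp add: divide_ennreal p_def mult.commute)
    qed
    finally have "\<mu> = density lborel (\<lambda>x. ennreal (p x))" unfolding \<mu>_def .
    moreover have "p \<in> borel_measurable lborel" unfolding p_def[abs_def] by measurable
    moreover have "0 \<le> p x" for x using sg f_nn by (simp add: p_def)
    ultimately show ?thesis unfolding has_density_real_def by blast
  qed
  have fin: "gauss_rel_entropy \<mu> < \<infinity>"
  proof (rule gauss_rel_entropy_finite[OF dens prob sq mean var])
    fix x assume px: "p x > 0"
    \<comment> \<open>In the original coordinate a point of positive density has
      \<open>y >= e\<close>. There \<open>ln y\<close> and \<open>ln (ln y)\<close> lie between 0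
      and \<open>y\<close>, and \<open>y\<close> is affine in \<open>x\<close>, hence below a
      quadratic.\<close>
    define y where "y = \<sigma> * x + m"
    have y: "y \<ge> e"
      using px by (cases "y \<ge> e") (auto simp: p_def f_def f0_def y_def)
    have l: "ln y \<ge> 1" "ln y \<le> y"
      using ln_e[OF y] y e ln_le_minus_one[of y] by auto
    then have ll: "ln (ln y) \<ge> 0" "ln (ln y) \<le> y"
      using ln_le_minus_one[of "ln y"] y e by auto
    have "p x = \<sigma> / I0 * (y powr (- s - 1) * ln y powr (- h))"
      using y by (simp add: p_def f_def f0_def y_def)
    also have "ln \<dots> = ln (\<sigma> / I0) + ((- s - 1) * ln y + (- h) * ln (ln y))"
      using y e l sg I0 by (subst ln_mult) (auto simp: ln_mult ln_powr)
    finally have "ln (p x) = ln (\<sigma> / I0) - (s + 1) * ln y - h * ln (ln y)"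
      by (simp add: algebra_simps)
    moreover have "(s + 1) * ln y \<ge> 0" "(s + 1) * ln y \<le> (s + 1) * y"
      "h * ln (ln y) \<ge> 0" "h * ln (ln y) \<le> h * y"
      using l ll s h by auto
    ultimately have "\<bar>ln (p x)\<bar> \<le> \<bar>ln (\<sigma> / I0)\<bar> + (s + 1 + h) * y"
      by (simp add: distrib_right abs_le_iff) linarith
    also have "y \<le> m + \<sigma> + \<sigma> * x\<^sup>2"
    proof -
      have "0 \<le> (x - 1)\<^sup>2 + x\<^sup>2 + 1" by simp
      then have "x \<le> 1 + x\<^sup>2" by (simp add: power2_diff)
      then have "\<sigma> * x \<le> \<sigma> * (1 + x\<^sup>2)" using sg by simp
      then show ?thesis by (simp add: y_def algebra_simps)
    qed
    then have "\<bar>ln (\<sigma> / I0)\<bar> + (s + 1 + h) * y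
        \<le> \<bar>ln (\<sigma> / I0)\<bar> + (s + 1 + h) * (m + \<sigma> + \<sigma> * x\<^sup>2)"
      using s h by (intro add_left_mono mult_left_mono) auto
    finally show "\<bar>ln (p x)\<bar> \<le> (\<bar>ln (\<sigma> / I0)\<bar> + (s + 1 + h) * (m + \<sigma>)) + ((s + 1 + h) * \<sigma>) * x\<^sup>2"
      by (simp add: algebra_simps)
  qed
  \<comment> \<open>For \<open>u >= u0\<close> the point \<open>w = m + \<sigma> * u\<close>
    satisfies \<open>e <= w <= 2 * \<sigma> * u\<close>, whence the factor
    \<open>(4 * \<sigma>) powr (- s)\<close>. The entry \<open>4 * \<sigma>\<close> of
    \<open>u0\<close> gives \<open>2 * w <= u * u\<close>, so \<open>ln (2 * w) <= 2 * ln u\<close>,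
    whence \<open>2 powr (- h)\<close>. The rest of \<open>K\<close> comes from \<open>tail0\<close>
    and the normalisation.\<close>
  define K where "K = (4 * \<sigma>) powr (- s) * 2 powr (- h) / 2 / I0"
  define u0 where "u0 = Max {e, e / \<sigma>, m / \<sigma>, 4 * \<sigma>}"
  have K: "K > 0" using sg I0 by (simp add: K_def)
  have tail: "K * (u powr (- s) * ln u powr (- h)) \<le> measure \<mu> {u<..}" if u: "u \<ge> u0" for u
  proof -
    have u': "u \<ge> e" "u \<ge> e / \<sigma>" "u \<ge> m / \<sigma>" "u \<ge> 4 * \<sigma>"
      using u by (auto simp: u0_def)
    define w where "w = m + \<sigma> * u"
    have w: "w \<ge> e" "w \<le> 2 * \<sigma> * u"
      using u' sg m0 by (auto simp: w_def field_simps)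
    have "(\<lambda>y. (y - m) / \<sigma>) -` {u<..} \<inter> space \<nu> = {w<..}"
      using sg by (auto simp: w_def \<nu>_def field_simps)
    then have "measure \<mu> {u<..} = measure \<nu> {w<..}"
      unfolding \<mu>_def by (subst measure_distr) auto
    also have "\<dots> \<ge> (2 * w) powr (- s) * ln (2 * w) powr (- h) / 2 / I0"
      unfolding meas_nu using tail0[OF w(1)] I0 by (intro divide_right_mono) auto
    finally have 1: "(2 * w) powr (- s) * ln (2 * w) powr (- h) / 2 / I0 \<le> measure \<mu> {u<..}" .
    have "(4 * \<sigma>) powr (- s) * u powr (- s) = (4 * \<sigma> * u) powr (- s)"
      using sg u' e by (subst powr_mult) auto
    also have "\<dots> \<le> (2 * w) powr (- s)"
      using w e s by (intro powr_mono2') auto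
    finally have 2: "(4 * \<sigma>) powr (- s) * u powr (- s) \<le> (2 * w) powr (- s)" .
    have "ln (2 * w) \<le> ln (u * u)"
    proof (subst ln_le_cancel_iff)
      have "2 * w \<le> 4 * \<sigma> * u" using w by simp
      also have "\<dots> \<le> u * u" using u' e by (intro mult_right_mono) auto
      finally show "2 * w \<le> u * u" .
    qed (use w e u' in auto)
    also have "\<dots> = 2 * ln u" using u' e by (simp add: ln_mult)
    finally have "(2 * ln u) powr (- h) \<le> ln (2 * w) powr (- h)"
      using w e h ln_e[of "2 * w"] by (intro powr_mono2') auto
    then have 3: "2 powr (- h) * ln u powr (- h) \<le> ln (2 * w) powr (- h)"
      using u' e ln_e[of u] by (subst (asm) powr_mult) auto
    have "K * (u powr (- s) * ln u powr (- h))
        = ((4 * \<sigma>) powr (- s) * u powr (- s)) * (2 powr (- h) * ln u powr (- h)) / 2 / I0"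
      by (simp add: K_def)
    also have "\<dots> \<le> (2 * w) powr (- s) * ln (2 * w) powr (- h) / 2 / I0"
      using 2 3 I0 by (intro divide_right_mono mult_mono) auto
    finally show ?thesis using 1 by linarith
  qed
  show ?thesis
    by (rule that[OF prob sets sq mean var abs_s fin K tail])
qed

section \<open>Comparison of the rates for large \<open>n\<close>\<close>

text \<open>If the target rate is \<open>1 / W\<close>, the main term is a constant times
  \<open>ln n powr (\<eta> - h) / W\<close>, eventually at least \<open>2 / W\<close> since
  \<open>h < \<eta>\<close>. The error \<open>1 / n\<close> is at most \<open>1 / W\<close> because
  \<open>s < 4\<close> makes the exponent \<open>a\<close> of \<open>n\<close> in \<open>W\<close>
  smaller than 1.\<close>

lemma eventually_tail_rate:
  fixes K s h \<eta> :: real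
  assumes K: "K > 0" and s: "2 < s" "s < 4" and h: "h < \<eta>"
  shows "\<forall>\<^sub>F n in sequentially.
    1 / ((real n * ln (real n)) powr ((s - 2) / 2) * ln (real n) powr \<eta>)
    \<le> real n * (K * ((3 * sqrt (real n * ln (real n))) powr (- s) * ln (real n) powr (- h))) / 2
        * ln (real n) - 1 / real n"
proof -
  define a where "a = (s - 2) / 2"
  define K' where "K' = K * 3 powr (- s) / 2"
  have a: "0 < a" "a < 1" and K': "K' > 0" using s K by (auto simp: a_def K'_def)
  have "((\<lambda>n. real n powr (a - 1) * ln (real n) powr (a + \<eta>)) \<longlongrightarrow> 0) sequentially"
    using a by real_asymp
  then have 1: "\<forall>\<^sub>F n in sequentially. real n powr (a - 1) * ln (real n) powr (a + \<eta>) < 1"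
    by (rule order_tendstoD) simp
  have "filterlim (\<lambda>n. K' * ln (real n) powr (\<eta> - h)) at_top sequentially"
    using h K' by real_asymp
  then have 2: "\<forall>\<^sub>F n in sequentially. 2 \<le> K' * ln (real n) powr (\<eta> - h)"
    by (simp add: filterlim_at_top)
  have 3: "\<forall>\<^sub>F n in sequentially. n \<ge> (3::nat)" by (rule eventually_ge_at_top)
  show ?thesis
    using 1 2 3
  proof eventually_elim
    case (elim n)
    define x where "x = real n"
    define L where "L = ln x"
    define W where "W = (x * L) powr a * L powr \<eta>"
    have x: "x \<ge> 3" using elim by (simp add: x_def)
    then have L: "L > 0" by (simp add: L_def)
    have W: "W > 0" using x L by (simp add: W_def)
    have "(3 * sqrt (x * L)) powr (- s) = 3 powr (- s) * (x * L) powr (- s / 2)"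
      using x L by (simp add: powr_mult powr_half_sqrt[symmetric] powr_powr)
    \<comment> \<open>Here \<open>s / 2 = a + 1\<close>; the extra factor \<open>x * L\<close>
      cancels against the number of summands and the logarithm of the likelihood ratio.\<close>
    also have "(x * L) powr (- s / 2) = (x * L) powr (- a) / (x * L)"
      using x L powr_diff[of "x * L" "- a" 1] by (simp add: a_def field_simps)
    finally have "x * (K * ((3 * sqrt (x * L)) powr (- s) * L powr (- h))) / 2 * L
        = K' * ((x * L) powr (- a) * L powr (- h))"
      using x L by (simp add: K'_def field_simps)
    also have "\<dots> = K' * L powr (\<eta> - h) / W"
      using x L by (simp add: W_def powr_minus powr_diff field_simps)
    finally have A: "x * (K * ((3 * sqrt (x * L)) powr (- s) * L powr (- h))) / 2 * L
        = K' * L powr (\<eta> - h) / W" .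
    have "x powr (a - 1) * L powr (a + \<eta>) = W / x"
      using x L by (simp add: W_def powr_diff powr_add powr_mult)
    then have "W / x < 1" using elim by (simp add: x_def L_def)
    then have B: "1 / x \<le> 1 / W" using x W by (simp add: field_simps)
    have "2 / W \<le> K' * L powr (\<eta> - h) / W"
      using elim W by (intro divide_right_mono) (auto simp: x_def L_def)
    then have "1 / W \<le> x * (K * ((3 * sqrt (x * L)) powr (- s) * L powr (- h))) / 2 * L - 1 / x"
      using A B by linarith
    then show ?case by (simp add: W_def x_def L_def a_def)
  qed
qed

section \<open>The i.i.d. sequence on the product space and the entropy of its normalised
  sums\<close>

theorem theorem1p3:
  "\<forall>\<eta>::real. \<eta> > 1 \<longrightarrow>
    (\<exists>c::real. c > 0 \<and>
      (\<forall>s::real. 2 < s \<and> s < 4 \<longrightarrow>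
        (\<exists>(M :: (nat \<Rightarrow> real) measure) (X :: nat \<Rightarrow> (nat \<Rightarrow> real) \<Rightarrow> real).
           prob_space M \<and>
           (\<forall>i. X i \<in> borel_measurable M) \<and>
           prob_space.indep_vars M (\<lambda>_. borel) X {1..} \<and>
           (\<forall>i\<ge>1. distr M borel (X i) = distr M borel (X 1)) \<and>
           integrable M (X 1) \<and> (\<integral>\<omega>. X 1 \<omega> \<partial>M) = 0 \<and>
           integrable M (\<lambda>\<omega>. (X 1 \<omega>)\<^sup>2) \<and> (\<integral>\<omega>. (X 1 \<omega>)\<^sup>2 \<partial>M) = 1 \<and>
           integrable M (\<lambda>\<omega>. \<bar>X 1 \<omega>\<bar> powr s) \<and>
           gauss_rel_entropy (distr M lborel (X 1)) < \<infinity> \<and>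
           (\<exists>n1::nat. \<forall>n\<ge>n1.
              ereal (c / (((real n * ln (real n)) powr ((s - 2) / 2)) * (ln (real n)) powr \<eta>))
                \<le> gauss_rel_entropy
                     (distr M lborel (\<lambda>\<omega>. (\<Sum>i=1..n. X i \<omega>) / sqrt (real n)))))))"
proof (intro allI impI exI[of _ "1 :: real"] conjI)
  fix \<eta> s :: real
  assume eta: "\<eta> > 1" and s: "2 < s \<and> s < 4"
  \<comment> \<open>Any value strictly between 1 and \<open>\<eta>\<close> serves:
    \<open>h > 1\<close> gives the moment of order \<open>s\<close>, and \<open>h < \<eta>\<close>
    leaves a power of \<open>ln n\<close> to absorb constants.\<close>
  define h where "h = (1 + \<eta>) / 2"
  have h: "h > 1" "h < \<eta>" using eta by (auto simp: h_def)
  obtain \<mu> :: "real measure" and K u0 :: real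
    where mu: "prob_space \<mu>" "sets \<mu> = sets borel"
      "integrable \<mu> (\<lambda>x. x\<^sup>2)" "(\<integral>x. x \<partial>\<mu>) = 0" "(\<integral>x. x\<^sup>2 \<partial>\<mu>) = 1"
      "integrable \<mu> (\<lambda>x. \<bar>x\<bar> powr s)" "gauss_rel_entropy \<mu> < \<infinity>" and K: "K > 0"
      and tail: "\<And>u. u \<ge> u0 \<Longrightarrow> K * (u powr (- s) * ln u powr (- h)) \<le> measure \<mu> {u<..}"
    using heavy_tail_law[of s h] s h by metis
  define M where "M = (\<Pi>\<^sub>M i\<in>(UNIV :: nat set). \<mu>)"
  define X :: "nat \<Rightarrow> (nat \<Rightarrow> real) \<Rightarrow> real" where "X i \<omega> = \<omega> i" for i \<omega>
  interpret mu: prob_space \<mu> by fact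
  interpret P: product_prob_space "\<lambda>_::nat. \<mu>" UNIV ..
  interpret M: prob_space M unfolding M_def by (rule prob_space_PiM) (rule mu(1))
  have [measurable_cong]: "sets \<mu> = sets borel" by fact
  have [measurable]: "X i \<in> borel_measurable M" for i
    unfolding X_def[abs_def] M_def by measurable
  \<comment> \<open>The target is left general because laws are formed over both
    \<open>borel\<close> and \<open>lborel\<close>.\<close>
  have dX: "distr M N (X i) = \<mu>" if "sets N = sets borel" for i N
  proof -
    have "distr M N (X i) = distr M \<mu> (X i)"
      using that mu(2) by (intro distr_cong) auto
    then show ?thesis
      using P.PiM_component[of i] by (simp add: M_def X_def[abs_def])
  qed
  \<comment> \<open>The joint law of the coordinates is the law of the identity on \<open>M\<close>,
    which is the product of the marginals by construction.\<close>
  have ind: "M.indep_vars (\<lambda>_. borel) X UNIV"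
  proof (subst M.indep_vars_iff_distr_eq_PiM)
    have "distr M (\<Pi>\<^sub>M i\<in>UNIV. borel) (\<lambda>x. \<lambda>i\<in>UNIV. X i x) = distr M M (\<lambda>x. x)"
      by (intro distr_cong) (auto simp: X_def M_def mu(2) intro!: sets_PiM_cong)
    also have "\<dots> = (\<Pi>\<^sub>M i\<in>UNIV. distr M borel (X i))"
      unfolding dX[OF refl] by (simp add: M_def)
    finally show "distr M (\<Pi>\<^sub>M i\<in>UNIV. borel) (\<lambda>x. \<lambda>i\<in>UNIV. X i x)
      = (\<Pi>\<^sub>M i\<in>UNIV. distr M borel (X i))" .
  qed auto
  have intX: "integrable M (\<lambda>\<omega>. g (X i \<omega>)) \<longleftrightarrow> integrable \<mu> g"
    and expX: "(\<integral>\<omega>. g (X i \<omega>) \<partial>M) = (\<integral>x. g x \<partial>\<mu>)"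
    if [measurable]: "g \<in> borel_measurable borel" for g :: "real \<Rightarrow> real" and i
    using integrable_distr_eq[of "X i" M borel g] integral_distr[of "X i" M borel g] by (auto simp: dX)
  have X2: "integrable M (\<lambda>\<omega>. (X i \<omega>)\<^sup>2)" "M.expectation (X i) = 0"
    "M.expectation (\<lambda>\<omega>. (X i \<omega>)\<^sup>2) = 1" for i
    using intX[of "\<lambda>x. x\<^sup>2" i] expX[of "\<lambda>x. x\<^sup>2" i] expX[of "\<lambda>x. x" i] mu by auto
  have X1: "integrable M (X i)" for i
    using X2(1)[of i] by (rule M.square_integrable_imp_integrable[rotated]) auto
  define Z where "Z n \<omega> = (\<Sum>i=1..n. X i \<omega>) / sqrt (real n)" for n \<omega>
  have [measurable]: "Z n \<in> borel_measurable M" for n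
    unfolding Z_def[abs_def] by measurable
  \<comment> \<open>For \<open>n = 0\<close> division by zero makes \<open>Z 0\<close> identically
    0, with mean 0 but also variance 0; hence the condition on the variance.\<close>
  have Zmean: "(\<integral>x. x \<partial>distr M lborel (Z n)) = 0"
    and Zvar: "n \<ge> 1 \<Longrightarrow> (\<integral>x. x\<^sup>2 \<partial>distr M lborel (Z n)) = 1" for n
    using M.indep_sum_second_moment[of "{1..n}" X] M.indep_vars_subset[OF ind, of "{1..n}"] X2
    by (auto simp: integral_distr Z_def power_divide)
  have lower: "measure \<mu> {3 * sqrt (real n * ln (real n))<..} * real n / 2
      \<le> measure (distr M lborel (Z n)) {2 * sqrt (ln (real n))<..}"
    if n: "n \<ge> 1" "ln (real n) \<ge> 4" for n
  proof -
    define L where "L = ln (real n)"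
    define v where "v = 3 * sqrt (real n * L)"
    \<comment> \<open>From \<open>L >= 4\<close> follows \<open>2 * sqrt n <= sqrt (n * L)\<close>,
      so a jump above \<open>v\<close> survives the loss of \<open>2 * sqrt n\<close> and still
      leaves \<open>2 * sqrt L\<close> after division by \<open>sqrt n\<close>.\<close>
    have "sqrt 4 \<le> sqrt L" using n unfolding L_def by (simp only: real_sqrt_le_iff)
    then have "2 \<le> sqrt L" by simp
    then have "2 * sqrt (real n) \<le> sqrt (real n) * sqrt L" using n by (simp add: mult.commute)
    then have v: "2 * sqrt (real n) + 2 * sqrt L * sqrt (real n) \<le> v" "2 * sqrt (real n) \<le> v"
      using n by (auto simp: v_def real_sqrt_mult L_def)
    have tl: "M.prob {\<omega>\<in>space M. X i \<omega> > v} = measure \<mu> {v<..}" for i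
    proof -
      have "measure \<mu> {v<..} = measure (distr M borel (X i)) {v<..}" by (simp add: dX)
      also have "\<dots> = M.prob {\<omega>\<in>space M. X i \<omega> > v}"
        by (subst measure_distr) (auto intro!: arg_cong[where f = M.prob])
      finally show ?thesis by simp
    qed
    have "real (card {1..n}) * measure \<mu> {v<..} / 2
        \<le> M.prob {\<omega>\<in>space M. (\<Sum>i\<in>{1..n}. X i \<omega>) > v - 2 * sqrt (card {1..n})}"
      using X2 tl v M.indep_vars_subset[OF ind, of "{1..n}"]
      by (intro M.indep_sum_one_big_jump) auto
    also have "\<dots> \<le> M.prob (Z n -` {2 * sqrt L<..} \<inter> space M)"
    proof (rule M.finite_measure_mono)
      show "{\<omega>\<in>space M. (\<Sum>i\<in>{1..n}. X i \<omega>) > v - 2 * sqrt (card {1..n})}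
          \<subseteq> Z n -` {2 * sqrt L<..} \<inter> space M"
        using v n by (auto simp: Z_def less_divide_eq)
    qed measurable
    also have "\<dots> = measure (distr M lborel (Z n)) {2 * sqrt L<..}"
      by (subst measure_distr) auto
    finally show ?thesis by (simp add: L_def v_def mult.commute)
  qed
  have ev: "\<forall>\<^sub>F n in sequentially. ereal (1 / ((real n * ln (real n)) powr ((s - 2) / 2) * ln (real n) powr \<eta>))
      \<le> gauss_rel_entropy (distr M lborel (Z n))"
  proof -
    \<comment> \<open>\<open>a1\<close> serves \<open>lower\<close> and \<open>a2\<close> the tail
      estimate; \<open>a3\<close> and \<open>a4\<close> give \<open>0 < ln v <= ln n\<close>, so
      that \<open>ln v powr (- h)\<close> may be replaced by the smaller
      \<open>ln n powr (- h)\<close>.\<close>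
    have a1: "\<forall>\<^sub>F n in sequentially. ln (real n) \<ge> 4" by real_asymp
    have a2: "\<forall>\<^sub>F n in sequentially. 3 * sqrt (real n * ln (real n)) \<ge> u0" by real_asymp
    have a3: "\<forall>\<^sub>F n in sequentially. 3 * sqrt (real n * ln (real n)) \<le> real n" by real_asymp
    have a4: "\<forall>\<^sub>F n in sequentially. 3 * sqrt (real n * ln (real n)) > 1" by real_asymp
    have a5: "\<forall>\<^sub>F n in sequentially. n \<ge> (1 :: nat)" by (rule eventually_ge_at_top)
    have "s > 2" "s < 4" using s by auto
    from eventually_tail_rate[OF K this h(2)] a1 a2 a3 a4 a5 show ?thesis
    proof eventually_elim
      case (elim n)
      define L where "L = ln (real n)"
      define v where "v = 3 * sqrt (real n * L)"
      define Q where "Q = measure (distr M lborel (Z n)) {2 * sqrt L<..}"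
      have v: "v \<ge> u0" "v \<le> real n" "v > 1" and L: "L \<ge> 4" and n: "n \<ge> 1"
        using elim by (auto simp: v_def L_def)
      have "ln v > 0" "ln v \<le> L" using v n by (auto simp: L_def)
      then have "L powr (- h) \<le> ln v powr (- h)" using h by (intro powr_mono2') auto
      then have "K * (v powr (- s) * L powr (- h)) \<le> K * (v powr (- s) * ln v powr (- h))"
        using K by (intro mult_left_mono) auto
      also have "\<dots> \<le> measure \<mu> {v<..}" using v by (intro tail)
      finally have "real n * (K * (v powr (- s) * L powr (- h))) / 2 \<le> measure \<mu> {v<..} * real n / 2"
        by (simp add: mult.commute mult_left_mono)
      also have "\<dots> \<le> Q" using lower[of n] n L by (simp add: v_def L_def Q_def)
      finally have "real n * (K * (v powr (- s) * L powr (- h))) / 2 * L \<le> Q * L"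
        using L by (intro mult_right_mono) auto
      then have "1 / ((real n * L) powr ((s - 2) / 2) * L powr \<eta>) \<le> Q * L - 1 / real n"
        using elim(1) unfolding v_def L_def by linarith
      \<comment> \<open>The entropy bound is applied with \<open>r = n\<close> and
        \<open>T = 2 * sqrt L\<close>: then \<open>ln r = L\<close>, and the normal tail contributes
        \<open>n\<close> times \<open>n^(-2)\<close>.\<close>
      also have "1 / real n = real n * exp (- (2 * sqrt L)\<^sup>2 / 2)"
      proof -
        have "exp (- (2 * sqrt L)\<^sup>2 / 2) = exp (- L) * exp (- L)"
          using L by (simp add: power_mult_distrib exp_add[symmetric])
        also have "exp (- L) = 1 / real n" using n by (simp add: L_def exp_minus field_simps)
        finally show ?thesis using n by simp
      qed
      finally have "ereal (1 / ((real n * L) powr ((s - 2) / 2) * L powr \<eta>))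
          \<le> ereal (Q * L - real n * exp (- (2 * sqrt L)\<^sup>2 / 2))" by simp
      also have "\<dots> \<le> gauss_rel_entropy (distr M lborel (Z n))"
        unfolding Q_def L_def using n L Zmean Zvar
        by (intro gauss_rel_entropy_ge_tail M.prob_space_distr) (auto simp: L_def)
      finally show ?case unfolding L_def .
    qed
  qed
  then obtain n1 where n1: "\<And>n. n \<ge> n1 \<Longrightarrow>
      ereal (1 / ((real n * ln (real n)) powr ((s - 2) / 2) * ln (real n) powr \<eta>))
      \<le> gauss_rel_entropy (distr M lborel (Z n))"
    unfolding eventually_sequentially by blast
  have D1: "gauss_rel_entropy (distr M lborel (X 1)) < \<infinity>" using mu(7) by (simp add: dX)
  have Xs: "integrable M (\<lambda>\<omega>. \<bar>X 1 \<omega>\<bar> powr s)"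
    using intX[of "\<lambda>x. \<bar>x\<bar> powr s" 1] mu(6) by simp
  show "\<exists>(M :: (nat \<Rightarrow> real) measure) (X :: nat \<Rightarrow> (nat \<Rightarrow> real) \<Rightarrow> real).
           prob_space M \<and>
           (\<forall>i. X i \<in> borel_measurable M) \<and>
           prob_space.indep_vars M (\<lambda>_. borel) X {1..} \<and>
           (\<forall>i\<ge>1. distr M borel (X i) = distr M borel (X 1)) \<and>
           integrable M (X 1) \<and> (\<integral>\<omega>. X 1 \<omega> \<partial>M) = 0 \<and>
           integrable M (\<lambda>\<omega>. (X 1 \<omega>)\<^sup>2) \<and> (\<integral>\<omega>. (X 1 \<omega>)\<^sup>2 \<partial>M) = 1 \<and>
           integrable M (\<lambda>\<omega>. \<bar>X 1 \<omega>\<bar> powr s) \<and>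
           gauss_rel_entropy (distr M lborel (X 1)) < \<infinity> \<and>
           (\<exists>n1::nat. \<forall>n\<ge>n1.
              ereal (1 / (((real n * ln (real n)) powr ((s - 2) / 2)) * (ln (real n)) powr \<eta>))
                \<le> gauss_rel_entropy
                     (distr M lborel (\<lambda>\<omega>. (\<Sum>i=1..n. X i \<omega>) / sqrt (real n))))"
    using M.prob_space_axioms M.indep_vars_subset[OF ind, of "{1..}"] X1 X2 Xs D1 n1
    by (intro exI[of _ M] exI[of _ X]) (auto simp: dX Z_def[abs_def])
qed simp

end
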